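(* Let $f$ be a harmonic mapping in the unit disc $\mathbb{D}$ and let $\varphi:[0,1)\to(0,\infty)$ be an increasing function such that $1/\varphi$ is convex and $\lim_{r\to1^-}\varphi(r)(1-r)=\infty$. If $f$ is $\varphi$-normal, then for any sequence $\{z_n\}_{n=1}^\infty$ of points in $\mathbb{D}$ such that $\lim_{n\to\infty}|z_n|=1$, the family $$\left\{z\mapsto f\left(z_n+\frac{z}{\varphi(|z_n|)}\right):n\in\mathbb{Z}_+\right\}$$ is normal in $\mathbb{C}$.
   Context: $\mathbb{D}=\{z\in\mathbb{C}:|z|<1\}$ and $\mathbb{Z}_+$ is the set of positive integers. A harmonic mapping $f$ on a simply connected domain $D\subset\mathbb{C}$ is a complex-valued harmonic function; it has the canonical decomposition $f=h+\overline{g}$ with $h,g$ analytic in $D$ and $g(z_0)=0$ at some prescribed point $z_0\in D$. For such $f$ put $$f^{\#}(z)=\frac{|h'(z)|+|g'(z)|}{1+|f(z)|^2}.$$ A harmonic mapping $f$ in $\mathbb{D}$ is $\varphi$-normal if $\sup_{z\in\mathbb{D}} f^{\#}(z)/\varphi(|z|)<\infty$. Normality is in the sense of Montel: a family is normal if every sequence of its members has a subsequence converging locally uniformly with respect to the spherical (chordal) metric on $\mathbb{C}\cup\{\infty\}$ (so divergence to $\infty$, locally uniformly, is allowed). The function $z\mapsto f(z_n+z/\varphi(|z_n|))$ is defined at least on the disc $|z|<\varphi(|z_n|)(1-|z_n|)$, whose radius tends to $\infty$; thus on any compact subset of $\mathbb{C}$ all but finitely many of these functions are defined, and normality in $\mathbb{C}$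 is understood accordingly: every sequence of the functions with indices tending to infinity has a subsequence that converges uniformly, in the spherical metric, on each compact subset of $\mathbb{C}$. *)

theory Defs
  imports "HOL-Complex_Analysis.Complex_Analysis"
begin

text \<open>A complex-valued function is harmonic on the open set \<open>D\<close> if it is twice continuously
  differentiable in the real sense and satisfies Laplace's equation. The functions \<open>fx\<close>, \<open>fy\<close>
  are the first partial derivatives of \<open>f\<close> with respect to \<open>x = Re z\<close> and \<open>y = Im z\<close>;
  \<open>fxx\<close>, \<open>fxy\<close> and \<open>fyx\<close>, \<open>fyy\<close> are those of \<open>fx\<close> and of \<open>fy\<close>.\<close>

definition harmonic_on :: "(complex \<Rightarrow> complex) \<Rightarrow> complex set \<Rightarrow> bool" where
  "harmonic_on f D \<longleftrightarrow> open D \<and>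
     (\<exists>fx fy fxx fxy fyx fyy.
        (\<forall>z\<in>D. (f has_derivative (\<lambda>w. Re w *\<^sub>R fx z + Im w *\<^sub>R fy z)) (at z)) \<and>
        (\<forall>z\<in>D. (fx has_derivative (\<lambda>w. Re w *\<^sub>R fxx z + Im w *\<^sub>R fxy z)) (at z)) \<and>
        (\<forall>z\<in>D. (fy has_derivative (\<lambda>w. Re w *\<^sub>R fyx z + Im w *\<^sub>R fyy z)) (at z)) \<and>
        continuous_on D fxx \<and> continuous_on D fxy \<and>
        continuous_on D fyx \<and> continuous_on D fyy \<and>
        (\<forall>z\<in>D. fxx z + fyy z = 0))"

definition canonical_decomposition ::
  "complex set \<Rightarrow> complex \<Rightarrow> (complex \<Rightarrow> complex) \<Rightarrow> (complex \<Rightarrow> complex) \<Rightarrow> (complex \<Rightarrow> complex) \<Rightarrow> bool"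
where
  "canonical_decomposition D z0 f h g \<longleftrightarrow>
     h holomorphic_on D \<and> g holomorphic_on D \<and> g z0 = 0 \<and> (\<forall>z\<in>D. f z = h z + cnj (g z))"

text \<open>For simply connected \<open>D\<close> every harmonic \<open>f\<close> has a canonical decomposition, so the choice
  below is not vacuous; it is also harmless: on an open \<open>D\<close> the derivatives of \<open>h\<close> and \<open>g\<close> are determined
  by \<open>f\<close> alone (in particular they do not depend on \<open>z0\<close>), see \<open>harmonic_sharp_eq\<close>.\<close>

definition harmonic_sharp :: "complex set \<Rightarrow> complex \<Rightarrow> (complex \<Rightarrow> complex) \<Rightarrow> complex \<Rightarrow> real" where
  "harmonic_sharp D z0 f z =
     (let (h, g) = (SOME (h, g). canonical_decomposition D z0 f h g)
      in (norm (deriv h z) + norm (deriv g z)) / (1 + (norm (f z))\<^sup>2))"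

lemma canonical_decomposition_deriv_unique:
  assumes "open D" "z \<in> D"
    and "canonical_decomposition D z0 f h1 g1" "canonical_decomposition D z0' f h2 g2"
  shows "deriv h1 z = deriv h2 z" "deriv g1 z = deriv g2 z"
proof -
  define u where "u w = h1 w - h2 w" for w
  define v where "v w = g2 w - g1 w" for w
  have hol: "h1 holomorphic_on D" "h2 holomorphic_on D" "g1 holomorphic_on D" "g2 holomorphic_on D"
    using assms by (auto simp: canonical_decomposition_def)
  note dv = holomorphic_derivI[OF _ \<open>open D\<close> \<open>z \<in> D\<close>]
  have du: "(u has_field_derivative deriv h1 z - deriv h2 z) (at z)"
    unfolding u_def by (intro derivative_intros dv hol)
  have dv: "(v has_field_derivative deriv g2 z - deriv g1 z) (at z)"
    unfolding v_def by (intro derivative_intros dv hol)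
  have eq: "u w = cnj (v w)" if "w \<in> D" for w
    using assms(3,4) that
    by (auto simp: canonical_decomposition_def u_def v_def algebra_simps)
  have "((\<lambda>w. cnj (v w)) has_derivative (\<lambda>w. cnj ((deriv g2 z - deriv g1 z) * w))) (at z)"
    using has_derivative_cnj dv unfolding has_field_derivative_def by blast
  then have "(u has_derivative (\<lambda>w. cnj ((deriv g2 z - deriv g1 z) * w))) (at z)"
    by (rule has_derivative_transform_within_open[OF _ \<open>open D\<close> \<open>z \<in> D\<close>]) (simp add: eq)
  then have *: "(\<lambda>w. (deriv h1 z - deriv h2 z) * w) = (\<lambda>w. cnj ((deriv g2 z - deriv g1 z) * w))"
    using du has_derivative_unique unfolding has_field_derivative_def by blast
  have 1: "deriv h1 z - deriv h2 z = cnj (deriv g2 z - deriv g1 z)"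
    using fun_cong[OF *, of 1] by simp
  have 2: "(deriv h1 z - deriv h2 z) * \<i> = - cnj (deriv g2 z - deriv g1 z) * \<i>"
    using fun_cong[OF *, of \<i>] by (simp add: algebra_simps)
  then have "deriv h1 z - deriv h2 z = - cnj (deriv g2 z - deriv g1 z)"
    by (metis complex_i_not_zero mult_right_cancel)
  with 1 have "deriv h1 z - deriv h2 z = 0" "cnj (deriv g2 z - deriv g1 z) = 0"
    by simp_all
  then show "deriv h1 z = deriv h2 z" "deriv g1 z = deriv g2 z"
    by simp_all
qed

lemma harmonic_sharp_eq:
  assumes "open D" "z \<in> D" "canonical_decomposition D z0 f h g"
  shows "harmonic_sharp D z0 f z = (norm (deriv h z) + norm (deriv g z)) / (1 + (norm (f z))\<^sup>2)"
proof -
  obtain h' g' where hg': "(SOME (h, g). canonical_decomposition D z0 f h g) = (h', g')"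
    by fastforce
  have "case (h', g') of (h, g) \<Rightarrow> canonical_decomposition D z0 f h g"
    unfolding hg'[symmetric] by (rule someI[of _ "(h, g)"]) (simp add: assms)
  then have "canonical_decomposition D z0 f h' g'"
    by simp
  then show ?thesis
    using canonical_decomposition_deriv_unique[OF assms(1,2) _ assms(3)]
    unfolding harmonic_sharp_def hg' by simp
qed

definition phi_normal :: "(real \<Rightarrow> real) \<Rightarrow> complex \<Rightarrow> (complex \<Rightarrow> complex) \<Rightarrow> bool" where
  "phi_normal \<phi> z0 f \<longleftrightarrow> harmonic_on f (ball 0 1) \<and>
     bdd_above ((\<lambda>z. harmonic_sharp (ball 0 1) z0 f z / \<phi> (norm z)) ` ball 0 1)"

text \<open>The extended complex plane, equipped with the chordal metric.\<close>

datatype riemann_sphere = Fin complex | Infty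

text \<open>Inverse stereographic projection onto the unit sphere. The explicit formulas for the
  chordal distance are \<open>chordal_dist\<close> below.\<close>

primrec sphere_point :: "riemann_sphere \<Rightarrow> complex \<times> real" where
  "sphere_point (Fin z) = ((2 / (1 + (norm z)\<^sup>2)) *\<^sub>R z, ((norm z)\<^sup>2 - 1) / ((norm z)\<^sup>2 + 1))"
| "sphere_point Infty = (0, 1)"

lemma one_plus_sq_pos: "1 + (norm (z::complex))\<^sup>2 > 0"
  by (simp add: add_pos_nonneg)

lemma sphere_point_Fin_ne: "snd (sphere_point (Fin z)) \<noteq> 1"
  using one_plus_sq_pos[of z] by (simp add: field_simps)

lemma inj_sphere_point: "inj sphere_point"
proof (rule injI)
  fix p q assume eq: "sphere_point p = sphere_point q"
  have Fin: "z = w" if "sphere_point (Fin z) = sphere_point (Fin w)" for z w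
  proof -
    have "((norm z)\<^sup>2 - 1) / ((norm z)\<^sup>2 + 1) = ((norm w)\<^sup>2 - 1) / ((norm w)\<^sup>2 + 1)"
      using that by simp
    then have "(norm z)\<^sup>2 = (norm w)\<^sup>2"
      using one_plus_sq_pos[of z] one_plus_sq_pos[of w] by (simp add: field_simps)
    then show ?thesis
      using that one_plus_sq_pos[of w] by auto
  qed
  show "p = q"
    using eq Fin sphere_point_Fin_ne
    by (cases p; cases q) (metis sphere_point.simps(2) snd_conv)+
qed

instantiation riemann_sphere :: metric_space
begin

definition dist_riemann_sphere :: "riemann_sphere \<Rightarrow> riemann_sphere \<Rightarrow> real" where
  "dist_riemann_sphere p q = dist (sphere_point p) (sphere_point q)"

definition uniformity_riemann_sphere :: "(riemann_sphere \<times> riemann_sphere) filter" where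
  "uniformity_riemann_sphere = (INF e\<in>{0 <..}. principal {(x, y). dist x y < e})"

definition open_riemann_sphere :: "riemann_sphere set \<Rightarrow> bool" where
  "open_riemann_sphere U \<longleftrightarrow> (\<forall>x\<in>U. eventually (\<lambda>(x', y). x' = x \<longrightarrow> y \<in> U) uniformity)"

instance
proof
  fix x y z :: riemann_sphere
  show "dist x y = 0 \<longleftrightarrow> x = y"
    using inj_sphere_point by (auto simp: dist_riemann_sphere_def inj_eq)
  show "dist x y \<le> dist x z + dist y z"
    unfolding dist_riemann_sphere_def by (rule dist_triangle2)
qed (simp_all only: uniformity_riemann_sphere_def open_riemann_sphere_def)

end

lemma chordal_dist:
  "dist (Fin z) (Fin w) = 2 * norm (z - w) / (sqrt (1 + (norm z)\<^sup>2) * sqrt (1 + (norm w)\<^sup>2))"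
  "dist (Fin z) Infty = 2 / sqrt (1 + (norm z)\<^sup>2)"
proof -
  define a b where "a = 1 + (norm z)\<^sup>2" and "b = 1 + (norm w)\<^sup>2"
  have pos: "a > 0" "b > 0"
    using one_plus_sq_pos by (auto simp: a_def b_def)
  have n: "(norm z)\<^sup>2 = a - 1" "(norm w)\<^sup>2 = b - 1"
    by (auto simp: a_def b_def)
  have expand: "(dist ((2 / a) *\<^sub>R z) ((2 / b) *\<^sub>R w))\<^sup>2
      = 4 * (norm z)\<^sup>2 / a\<^sup>2 + 4 * (norm w)\<^sup>2 / b\<^sup>2 - 8 * (z \<bullet> w) / (a * b)"
    unfolding dist_norm power2_norm_eq_inner
    using pos by (simp add: inner_diff_left inner_diff_right inner_commute field_simps power2_eq_square)
  have nd: "(norm (z - w))\<^sup>2 = a + b - 2 - 2 * (z \<bullet> w)"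
    using n by (simp add: power2_norm_eq_inner inner_diff_left inner_diff_right inner_commute)
  have "(dist ((2 / a) *\<^sub>R z) ((2 / b) *\<^sub>R w))\<^sup>2 + (dist ((a - 2) / a) ((b - 2) / b))\<^sup>2
      = 4 * (norm (z - w))\<^sup>2 / (a * b)"
    unfolding expand nd n dist_real_def power2_abs using pos
    by (simp add: field_simps power2_eq_square)
  moreover have "sphere_point (Fin z) = ((2 / a) *\<^sub>R z, (a - 2) / a)"
    "sphere_point (Fin w) = ((2 / b) *\<^sub>R w, (b - 2) / b)"
    by (auto simp: a_def b_def algebra_simps)
  ultimately have "dist (Fin z) (Fin w) = sqrt (4 * (norm (z - w))\<^sup>2 / (a * b))"
    by (simp del: sphere_point.simps(1) add: dist_riemann_sphere_def dist_Pair_Pair)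
  also have "\<dots> = 2 * norm (z - w) / (sqrt a * sqrt b)"
    by (simp add: real_sqrt_divide real_sqrt_mult)
  finally show "dist (Fin z) (Fin w) = 2 * norm (z - w) / (sqrt (1 + (norm z)\<^sup>2) * sqrt (1 + (norm w)\<^sup>2))"
    by (simp add: a_def b_def)
  have "(norm ((2 / a) *\<^sub>R z))\<^sup>2 + (dist ((a - 2) / a) 1)\<^sup>2 = 4 / a"
    unfolding norm_scaleR power_mult_distrib n dist_real_def power2_abs using pos
    by (simp add: field_simps power2_eq_square)
  moreover have "sphere_point (Fin z) = ((2 / a) *\<^sub>R z, (a - 2) / a)"
    by (auto simp: a_def algebra_simps)
  ultimately have "dist (Fin z) Infty = sqrt (4 / a)"
    by (simp del: sphere_point.simps(1) add: dist_riemann_sphere_def dist_Pair_Pair)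
  then show "dist (Fin z) Infty = 2 / sqrt (1 + (norm z)\<^sup>2)"
    by (simp add: real_sqrt_divide a_def)
qed

text \<open>Montel normality in \<open>\<Omega>\<close> of a sequence of functions \<open>F n\<close>, each defined only on \<open>A n\<close>:
  every sequence of members whose indices tend to infinity has a subsequence converging
  uniformly on each compact \<open>K \<subseteq> \<Omega>\<close> in the chordal metric; the limit may take the value
  \<open>Infty\<close>. Outside \<open>A n\<close> the values of \<open>F n\<close> are meaningless, hence the requirement that \<open>K\<close>
  be eventually contained in the domains.\<close>

definition normal_sequence_in ::
  "complex set \<Rightarrow> (nat \<Rightarrow> complex set) \<Rightarrow> (nat \<Rightarrow> complex \<Rightarrow> complex) \<Rightarrow> bool" where
  "normal_sequence_in \<Omega> A F \<longleftrightarrow>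
     (\<forall>\<sigma>. filterlim \<sigma> at_top sequentially \<longrightarrow>
        (\<exists>\<rho> G. strict_mono \<rho> \<and>
          (\<forall>K. compact K \<and> K \<subseteq> \<Omega> \<longrightarrow>
             (\<forall>\<^sub>F k in sequentially. K \<subseteq> A (\<sigma> (\<rho> k))) \<and>
             uniform_limit K (\<lambda>k w. Fin (F (\<sigma> (\<rho> k)) w)) G sequentially)))"

end

theory Submission
  imports Defs "HOL-Library.Diagonal_Subsequence"
begin

text \<open>Since \<open>1/\<phi>\<close> is convex and \<open>o(1 - r)\<close>, its slope tends to \<open>0\<close> at \<open>1\<close>; hence \<open>\<phi>\<close> at most doubles on
  \<open>[0, a + R/\<phi>(a)]\<close> once \<open>a\<close> is close to \<open>1\<close>. So \<open>f\<^sup>#\<close> is at most \<open>2M\<phi>(|z\<^sub>n|)\<close> on the disc of radius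
  \<open>R/\<phi>(|z\<^sub>n|)\<close> about \<open>z\<^sub>n\<close>, and after rescaling the functions are, for the chordal metric, uniformly
  Lipschitz on every fixed disc. Arzela-Ascoli and a diagonal argument give normality.\<close>

section \<open>Symmetry of mixed partial derivatives\<close>

text \<open>The mean value theorem is applied twice: along \<open>d\<close> to the increment of
  \<open>u\<close> in the direction \<open>e\<close>, then along \<open>e\<close> to
  \<open>a\<close>. The directions are kept general so that they can be interchanged.\<close>

lemma mean_value_second_difference:
  fixes u a c :: "'a::real_normed_vector \<Rightarrow> real"
  assumes "s > 0"
    and u: "\<And>x y. x \<in> {0..s} \<Longrightarrow> y \<in> {0..s} \<Longrightarrow>
      ((\<lambda>t. u (p + t *\<^sub>R d + y *\<^sub>R e)) has_real_derivative a (p + x *\<^sub>R d + y *\<^sub>R e)) (at x)"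
    and a: "\<And>x y. x \<in> {0..s} \<Longrightarrow> y \<in> {0..s} \<Longrightarrow>
      ((\<lambda>t. a (p + x *\<^sub>R d + t *\<^sub>R e)) has_real_derivative c (p + x *\<^sub>R d + y *\<^sub>R e)) (at y)"
  shows "\<exists>x\<in>{0..s}. \<exists>y\<in>{0..s}.
    u (p + s *\<^sub>R d + s *\<^sub>R e) - u (p + s *\<^sub>R d) - u (p + s *\<^sub>R e) + u p = s\<^sup>2 * c (p + x *\<^sub>R d + y *\<^sub>R e)"
proof -
  define g where "g t = u (p + t *\<^sub>R d + s *\<^sub>R e) - u (p + t *\<^sub>R d)" for t
  have dg: "(g has_real_derivative a (p + x *\<^sub>R d + s *\<^sub>R e) - a (p + x *\<^sub>R d)) (at x)"
    if "0 \<le> x" "x \<le> s" for x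
    unfolding g_def using u[of x s] u[of x 0] that \<open>s > 0\<close>
    by (intro DERIV_diff) auto
  obtain x where x: "0 < x" "x < s" "g s - g 0 = (s - 0) * (a (p + x *\<^sub>R d + s *\<^sub>R e) - a (p + x *\<^sub>R d))"
    using MVT2[OF \<open>s > 0\<close> dg] by blast
  obtain y where y: "0 < y" "y < s"
    "a (p + x *\<^sub>R d + s *\<^sub>R e) - a (p + x *\<^sub>R d + 0 *\<^sub>R e) = (s - 0) * c (p + x *\<^sub>R d + y *\<^sub>R e)"
    using MVT2[OF \<open>s > 0\<close>, of "\<lambda>t. a (p + x *\<^sub>R d + t *\<^sub>R e)" "\<lambda>y. c (p + x *\<^sub>R d + y *\<^sub>R e)"] a x
    by auto
  have "g s - g 0 = s\<^sup>2 * c (p + x *\<^sub>R d + y *\<^sub>R e)"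
    using x y by (simp add: power2_eq_square)
  then show ?thesis
    using x y by (intro bexI[of _ x] bexI[of _ y]) (auto simp: g_def)
qed

text \<open>\<open>harmonic_on\<close> does not ask for equal mixed partials, so they are compared
  by Schwarz's argument: the second difference of \<open>u\<close> over a small square is
  independent of the order of the two directions, and it is the squared side times a value of
  \<open>uxy\<close>, and likewise of \<open>uyx\<close>, near \<open>p\<close>.\<close>

lemma symmetric_mixed_partials_real:
  fixes u ux uy :: "complex \<Rightarrow> real"
  assumes "open D" "p \<in> D"
    and u: "\<And>z. z \<in> D \<Longrightarrow> (u has_derivative (\<lambda>w. Re w * ux z + Im w * uy z)) (at z)"
    and ux: "\<And>z. z \<in> D \<Longrightarrow> (ux has_derivative (\<lambda>w. Re w * uxx z + Im w * uxy z)) (at z)"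
    and uy: "\<And>z. z \<in> D \<Longrightarrow> (uy has_derivative (\<lambda>w. Re w * uyx z + Im w * uyy z)) (at z)"
    and cont: "continuous_on D uxy" "continuous_on D uyx"
  shows "uxy p = uyx p"
proof (rule ccontr)
  assume ne: "uxy p \<noteq> uyx p"
  \<comment> \<open>Half the gap, so that a value within \<open>\<epsilon>\<close> of
    \<open>uxy p\<close> differs from any value within \<open>\<epsilon>\<close> of
    \<open>uyx p\<close>.\<close>
  define \<epsilon> where "\<epsilon> = dist (uxy p) (uyx p) / 2"
  have "\<epsilon> > 0"
    using ne by (simp add: \<epsilon>_def)
  have ax: "((\<lambda>t. v (q + t *\<^sub>R d)) has_real_derivative Re d * vx + Im d * vy) (at x)"
    if "(v has_derivative (\<lambda>w. Re w * vx + Im w * vy)) (at (q + x *\<^sub>R d))"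
    for v :: "complex \<Rightarrow> real" and q d x vx vy
  proof -
    have "((\<lambda>t. q + t *\<^sub>R d) has_derivative (\<lambda>t. t *\<^sub>R d)) (at x)"
      by (auto intro!: derivative_eq_intros)
    from has_derivative_compose[OF this that] show ?thesis
      unfolding has_field_derivative_def
      by (rule has_derivative_eq_rhs) (auto simp: algebra_simps)
  qed
  have "\<forall>\<^sub>F q in nhds p. q \<in> D \<and> dist (uxy q) (uxy p) < \<epsilon> \<and> dist (uyx q) (uyx p) < \<epsilon>"
    using cont assms(1,2) \<open>\<epsilon> > 0\<close>
    by (intro eventually_conj eventually_nhds_in_open tendstoD)
       (auto simp: continuous_on_eq_continuous_at isCont_def tendsto_at_iff_tendsto_nhds)
  then obtain r where "r > 0" and r: "\<And>q. dist q p < r \<Longrightarrow>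
      q \<in> D \<and> dist (uxy q) (uxy p) < \<epsilon> \<and> dist (uyx q) (uyx p) < \<epsilon>"
    unfolding eventually_nhds_metric by blast
  \<comment> \<open>Points of the square of side \<open>s\<close> at \<open>p\<close> are within
    \<open>2 * s\<close> of \<open>p\<close>, which is below \<open>r\<close>.\<close>
  define s where "s = r / 3"
  have "s > 0"
    using \<open>r > 0\<close> by (simp add: s_def)
  have near: "dist (p + x *\<^sub>R d + y *\<^sub>R e) p < r"
    if "x \<in> {0..s}" "y \<in> {0..s}" "norm d = 1" "norm e = 1" for x y d e
  proof -
    have "norm (x *\<^sub>R d + y *\<^sub>R e) \<le> \<bar>x\<bar> + \<bar>y\<bar>"
      using norm_triangle_ineq[of "x *\<^sub>R d" "y *\<^sub>R e"] that by simp
    also have "\<dots> < r"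
      using that \<open>r > 0\<close> by (simp add: s_def)
    finally show ?thesis
      by (simp add: dist_norm add.assoc)
  qed
  note D = r[OF near, THEN conjunct1]
  \<comment> \<open>\<open>ax\<close> has the moving term last; this reordering lets it treat a
    moving term in the middle.\<close>
  have sw: "q + t *\<^sub>R d + y *\<^sub>R e = (q + y *\<^sub>R e) + t *\<^sub>R d" for q d e :: complex and t y
    by simp
  have "\<exists>x\<in>{0..s}. \<exists>y\<in>{0..s}. u (p + s *\<^sub>R 1 + s *\<^sub>R \<i>) - u (p + s *\<^sub>R 1) - u (p + s *\<^sub>R \<i>) + u p
      = s\<^sup>2 * uxy (p + x *\<^sub>R 1 + y *\<^sub>R \<i>)"
  proof (rule mean_value_second_difference[OF \<open>s > 0\<close>])
    fix x y assume xy: "x \<in> {0..s}" "y \<in> {0..s}"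
    show "((\<lambda>t. u (p + t *\<^sub>R 1 + y *\<^sub>R \<i>)) has_real_derivative ux (p + x *\<^sub>R 1 + y *\<^sub>R \<i>)) (at x)"
      using ax[of u _ _ "p + y *\<^sub>R \<i>" x 1, folded sw, OF u, OF D] xy by simp
    show "((\<lambda>t. ux (p + x *\<^sub>R 1 + t *\<^sub>R \<i>)) has_real_derivative uxy (p + x *\<^sub>R 1 + y *\<^sub>R \<i>)) (at y)"
      using ax[of ux _ _ "p + x *\<^sub>R 1" y \<i>, OF ux, OF D] xy by simp
  qed
  then obtain x1 y1 where 1: "x1 \<in> {0..s}" "y1 \<in> {0..s}"
    "u (p + s *\<^sub>R 1 + s *\<^sub>R \<i>) - u (p + s *\<^sub>R 1) - u (p + s *\<^sub>R \<i>) + u p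
      = s\<^sup>2 * uxy (p + x1 *\<^sub>R 1 + y1 *\<^sub>R \<i>)" by blast
  have "\<exists>x\<in>{0..s}. \<exists>y\<in>{0..s}. u (p + s *\<^sub>R \<i> + s *\<^sub>R 1) - u (p + s *\<^sub>R \<i>) - u (p + s *\<^sub>R 1) + u p
      = s\<^sup>2 * uyx (p + x *\<^sub>R \<i> + y *\<^sub>R 1)"
  proof (rule mean_value_second_difference[OF \<open>s > 0\<close>])
    fix x y assume xy: "x \<in> {0..s}" "y \<in> {0..s}"
    show "((\<lambda>t. u (p + t *\<^sub>R \<i> + y *\<^sub>R 1)) has_real_derivative uy (p + x *\<^sub>R \<i> + y *\<^sub>R 1)) (at x)"
      using ax[of u _ _ "p + y *\<^sub>R 1" x \<i>, folded sw, OF u, OF D] xy by simp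
    show "((\<lambda>t. uy (p + x *\<^sub>R \<i> + t *\<^sub>R 1)) has_real_derivative uyx (p + x *\<^sub>R \<i> + y *\<^sub>R 1)) (at y)"
      using ax[of uy _ _ "p + x *\<^sub>R \<i>" y 1, OF uy, OF D] xy by simp
  qed
  then obtain x2 y2 where 2: "x2 \<in> {0..s}" "y2 \<in> {0..s}"
    "u (p + s *\<^sub>R \<i> + s *\<^sub>R 1) - u (p + s *\<^sub>R \<i>) - u (p + s *\<^sub>R 1) + u p
      = s\<^sup>2 * uyx (p + x2 *\<^sub>R \<i> + y2 *\<^sub>R 1)" by blast
  \<comment> \<open>Both sides are the same second difference, with the directions \<open>1\<close>
    and \<open>\<i>\<close> interchanged.\<close>
  have "s\<^sup>2 * uxy (p + x1 *\<^sub>R 1 + y1 *\<^sub>R \<i>) = s\<^sup>2 * uyx (p + x2 *\<^sub>R \<i> + y2 *\<^sub>R 1)"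
    unfolding 1(3)[symmetric] 2(3)[symmetric] by (simp add: add.commute add.left_commute)
  then have "uxy (p + x1 *\<^sub>R 1 + y1 *\<^sub>R \<i>) = uyx (p + x2 *\<^sub>R \<i> + y2 *\<^sub>R 1)"
    using \<open>s > 0\<close> by simp
  moreover have "dist (uxy (p + x1 *\<^sub>R 1 + y1 *\<^sub>R \<i>)) (uxy p) < \<epsilon>"
    using r[OF near[OF 1(1,2)]] by simp
  moreover have "dist (uyx (p + x2 *\<^sub>R \<i> + y2 *\<^sub>R 1)) (uyx p) < \<epsilon>"
    using r[OF near[OF 2(1,2)]] by simp
  ultimately show False
    unfolding \<epsilon>_def dist_real_def by argo
qed

text \<open>The mean value theorem concerns real-valued functions, hence the split into real and
  imaginary parts.\<close>

lemma symmetric_mixed_partials: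
  fixes f fx fy :: "complex \<Rightarrow> complex"
  assumes "open D" "p \<in> D"
    and f: "\<And>z. z \<in> D \<Longrightarrow> (f has_derivative (\<lambda>w. Re w *\<^sub>R fx z + Im w *\<^sub>R fy z)) (at z)"
    and fx: "\<And>z. z \<in> D \<Longrightarrow> (fx has_derivative (\<lambda>w. Re w *\<^sub>R fxx z + Im w *\<^sub>R fxy z)) (at z)"
    and fy: "\<And>z. z \<in> D \<Longrightarrow> (fy has_derivative (\<lambda>w. Re w *\<^sub>R fyx z + Im w *\<^sub>R fyy z)) (at z)"
    and cont: "continuous_on D fxy" "continuous_on D fyx"
  shows "fxy p = fyx p"
proof (rule complex_eqI)
  show "Re (fxy p) = Re (fyx p)"
    using has_derivative_Re[OF f] has_derivative_Re[OF fx] has_derivative_Re[OF fy] cont assms(1,2)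
    by (intro symmetric_mixed_partials_real[of D p "\<lambda>z. Re (f z)" "\<lambda>z. Re (fx z)" "\<lambda>z. Re (fy z)"
          "\<lambda>z. Re (fxx z)" "\<lambda>z. Re (fxy z)" "\<lambda>z. Re (fyx z)" "\<lambda>z. Re (fyy z)"])
       (auto intro: continuous_intros)
  show "Im (fxy p) = Im (fyx p)"
    using has_derivative_Im[OF f] has_derivative_Im[OF fx] has_derivative_Im[OF fy] cont assms(1,2)
    by (intro symmetric_mixed_partials_real[of D p "\<lambda>z. Im (f z)" "\<lambda>z. Im (fx z)" "\<lambda>z. Im (fy z)"
          "\<lambda>z. Im (fxx z)" "\<lambda>z. Im (fxy z)" "\<lambda>z. Im (fyx z)" "\<lambda>z. Im (fyy z)"])
       (auto intro: continuous_intros)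
qed

section \<open>Canonical decomposition on a convex domain\<close>

text \<open>The derivatives of \<open>h\<close> and \<open>g\<close> have to be the Wirtinger
  derivative \<open>p\<close> of \<open>f\<close> in z and the conjugate \<open>q\<close> of the one
  in the conjugate of z. Both are holomorphic because \<open>f\<close> is harmonic, and convexity of
  \<open>D\<close> supplies primitives.\<close>

lemma harmonic_on_imp_canonical_decomposition:
  assumes "harmonic_on f D" "convex D"
  obtains h g where "canonical_decomposition D z0 f h g"
proof -
  obtain fx fy fxx fxy fyx fyy where "open D"
    and f: "\<forall>z\<in>D. (f has_derivative (\<lambda>w. Re w *\<^sub>R fx z + Im w *\<^sub>R fy z)) (at z)"
    and fx: "\<forall>z\<in>D. (fx has_derivative (\<lambda>w. Re w *\<^sub>R fxx z + Im w *\<^sub>R fxy z)) (at z)"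
    and fy: "\<forall>z\<in>D. (fy has_derivative (\<lambda>w. Re w *\<^sub>R fyx z + Im w *\<^sub>R fyy z)) (at z)"
    and cont: "continuous_on D fxy" "continuous_on D fyx"
    and laplace: "\<forall>z\<in>D. fxx z + fyy z = 0"
    using assms(1) unfolding harmonic_on_def by (elim conjE exE) (rule that; assumption)
  note f = bspec[OF f] and fx = bspec[OF fx] and fy = bspec[OF fy] and laplace = bspec[OF laplace]
  have sym: "fyx z = fxy z" if "z \<in> D" for z
    using symmetric_mixed_partials[OF \<open>open D\<close> that f fx fy cont] by simp
  have yy: "fyy z = - fxx z" if "z \<in> D" for z
    using laplace[OF that] by (simp add: add_eq_0_iff)
  define p where "p z = (1 / 2) * (fx z - \<i> * fy z)" for z
  define q where "q z = cnj ((1 / 2) * (fx z + \<i> * fy z))" for z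
  \<comment> \<open>Symmetry of the mixed partials and Laplace's equation give the Cauchy-Riemann
    equations: the real-linear differential becomes multiplication by a complex number.\<close>
  have dp: "(p has_field_derivative (fxx z - \<i> * fxy z) / 2) (at z)" if "z \<in> D" for z
  proof -
    have "(p has_derivative (\<lambda>w. (1 / 2) * ((Re w *\<^sub>R fxx z + Im w *\<^sub>R fxy z)
        - \<i> * (Re w *\<^sub>R fyx z + Im w *\<^sub>R fyy z)))) (at z)"
      unfolding p_def using fx[OF that] fy[OF that]
      by (intro has_derivative_mult_right has_derivative_diff)
    moreover have "(1 / 2) * ((Re w *\<^sub>R fxx z + Im w *\<^sub>R fxy z)
        - \<i> * (Re w *\<^sub>R fyx z + Im w *\<^sub>R fyy z)) = (fxx z - \<i> * fxy z) / 2 * w" for w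
      by (simp add: sym yy that complex_eq_iff field_simps)
    ultimately show ?thesis
      unfolding has_field_derivative_def by (simp only:)
  qed
  have dq: "(q has_field_derivative cnj (fxx z + \<i> * fxy z) / 2) (at z)" if "z \<in> D" for z
  proof -
    have "(q has_derivative (\<lambda>w. cnj ((1 / 2) * ((Re w *\<^sub>R fxx z + Im w *\<^sub>R fxy z)
        + \<i> * (Re w *\<^sub>R fyx z + Im w *\<^sub>R fyy z))))) (at z)"
      unfolding q_def using fx[OF that] fy[OF that]
      by (intro has_derivative_cnj has_derivative_mult_right has_derivative_add)
    moreover have "cnj ((1 / 2) * ((Re w *\<^sub>R fxx z + Im w *\<^sub>R fxy z)
        + \<i> * (Re w *\<^sub>R fyx z + Im w *\<^sub>R fyy z))) = cnj (fxx z + \<i> * fxy z) / 2 * w" for w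
      by (simp add: sym yy that complex_eq_iff field_simps)
    ultimately show ?thesis
      unfolding has_field_derivative_def by (simp only:)
  qed
  have "p holomorphic_on D" "q holomorphic_on D"
    using dp dq \<open>open D\<close> by (auto simp: holomorphic_on_open)
  then obtain h g where hg: "\<And>z. z \<in> D \<Longrightarrow> (h has_field_derivative p z) (at z within D)"
      "\<And>z. z \<in> D \<Longrightarrow> (g has_field_derivative q z) (at z within D)"
    using holomorphic_convex_primitive'[OF \<open>convex D\<close> \<open>open D\<close>] by metis
  have "((\<lambda>z. f z - h z - cnj (g z)) has_derivative (\<lambda>w. 0)) (at z within D)" if "z \<in> D" for z
  proof -
    have "((\<lambda>z. f z - h z - cnj (g z)) has_derivative
        (\<lambda>w. (Re w *\<^sub>R fx z + Im w *\<^sub>R fy z) - p z * w - cnj (q z * w))) (at z within D)"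
      using hg[OF that] f[OF that] unfolding has_field_derivative_def
      by (intro has_derivative_diff has_derivative_cnj) (auto intro: has_derivative_at_withinI)
    \<comment> \<open>By the choice of \<open>p\<close> and \<open>q\<close>, the sum
      \<open>p z * w + cnj (q z * w)\<close> is the differential of \<open>f\<close>.\<close>
    moreover have "(Re w *\<^sub>R fx z + Im w *\<^sub>R fy z) - p z * w - cnj (q z * w) = 0" for w
      by (simp add: p_def q_def complex_eq_iff field_simps)
    ultimately show ?thesis
      by simp
  qed
  from has_derivative_zero_constant[OF \<open>convex D\<close> this] obtain c where c: "\<And>z. z \<in> D \<Longrightarrow> f z - h z - cnj (g z) = c"
    by blast
  have "h holomorphic_on D" "g holomorphic_on D"
    using hg by (auto simp: holomorphic_on_def field_differentiable_def)
  \<comment> \<open>\<open>g\<close> is shifted to vanish at \<open>z0\<close>; the first component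
    absorbs the conjugate of that shift and the constant \<open>c\<close>.\<close>
  then have "canonical_decomposition D z0 f (\<lambda>z. h z + c + cnj (g z0)) (\<lambda>z. g z - g z0)"
    unfolding canonical_decomposition_def using c
    by (auto intro!: holomorphic_intros simp: algebra_simps)
  then show thesis ..
qed

section \<open>Growth of \<open>\<phi>\<close> near 1\<close>

text \<open>For \<open>b < a < s\<close>, convexity puts \<open>1 / \<phi> a\<close> below the chord
  of \<open>1 / \<phi>\<close> over \<open>{b..s}\<close>. As \<open>s - a\<close> is at most
  \<open>R / \<phi> a\<close>, the value \<open>1 / \<phi> s\<close> falls short of
  \<open>1 / \<phi> a\<close> by at most a fraction of the latter; a suitable fixed \<open>b\<close>
  and \<open>a\<close> close to 1 make this fraction at most one half.\<close>

lemma phi_doubling: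
  fixes \<phi> :: "real \<Rightarrow> real"
  assumes pos: "\<And>r. r \<in> {0..<1} \<Longrightarrow> \<phi> r > 0"
    and mono: "mono_on {0..<1} \<phi>"
    and conv: "convex_on {0..<1} (\<lambda>r. 1 / \<phi> r)"
    and lim: "filterlim (\<lambda>r. \<phi> r * (1 - r)) at_top (at_left 1)"
    and "R \<ge> 0"
  shows "\<forall>\<^sub>F a in at_left 1. 0 < a \<and> a < 1 \<and> a + R / \<phi> a < 1 \<and>
    (\<forall>s\<in>{0..a + R / \<phi> a}. \<phi> s \<le> 2 * \<phi> a)"
proof -
  \<comment> \<open>The factor 4 yields the final one half: at the fixed \<open>b\<close> it gives
    \<open>R / \<phi> b < (1 - b) / 4\<close>, which is at most \<open>(a - b) / 2\<close> once
    \<open>a\<close> is beyond the midpoint of \<open>b\<close> and 1.\<close>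
  have large: "\<forall>\<^sub>F r in at_left 1. 4 * R < \<phi> r * (1 - r)"
    using lim by (auto simp: filterlim_at_top_dense)
  have pos_ev: "\<forall>\<^sub>F a in at_left (1::real). a \<in> {c<..<1}" if "c < 1" for c
    using that by (rule eventually_at_left_real)
  have "\<exists>b. 4 * R < \<phi> b * (1 - b) \<and> b \<in> {0<..<1}"
    by (rule eventually_happens'[OF _ eventually_conj[OF large pos_ev]]) auto
  then obtain b where b: "4 * R < \<phi> b * (1 - b)" "0 < b" "b < 1"
    by auto
  have "\<forall>\<^sub>F a in at_left 1. a \<in> {(1 + b) / 2<..<1}"
    using b by (intro pos_ev) auto
  with large show ?thesis
  proof eventually_elim
    case (elim a)
    then have a: "b < a" "0 < a" "a < 1" "a - b \<ge> (1 - b) / 2"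
      using b by (auto simp: field_simps)
    have \<phi>a: "\<phi> a > 0" and \<phi>b: "\<phi> b > 0"
      using pos a b by auto
    \<comment> \<open>The same growth bound, read at \<open>a\<close>, keeps
      \<open>a + R / \<phi> a\<close> below 1.\<close>
    have "R \<le> 4 * R"
      using \<open>R \<ge> 0\<close> by simp
    then have "R < \<phi> a * (1 - a)"
      using elim by linarith
    then have less1: "a + R / \<phi> a < 1"
      using \<phi>a by (simp add: field_simps)
    have "\<phi> s \<le> 2 * \<phi> a" if s: "0 \<le> s" "s \<le> a + R / \<phi> a" for s
    proof (cases "s \<le> a")
      case True
      then have "\<phi> s \<le> \<phi> a"
        using mono s a by (auto simp: mono_on_def)
      then show ?thesis
        using \<phi>a by simp
    next
      case False
      then have s1: "a < s" "s < 1"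
        using s less1 by auto
      then have \<phi>s: "\<phi> s > 0"
        using pos a by auto
      define A B S where "A = 1 / \<phi> a" and "B = 1 / \<phi> b" and "S = 1 / \<phi> s"
      have "S > 0" "A > 0" "B > 0"
        using \<phi>a \<phi>b \<phi>s by (auto simp: A_def B_def S_def)
      have "convex_on {b..s} (\<lambda>r. 1 / \<phi> r)"
        using convex_on_subset[OF conv] b s1 by (simp add: subset_eq)
      from convex_onD_Icc'[OF this, of a] have "A \<le> (S - B) / (s - b) * (a - b) + B"
        using a s1 by (simp add: A_def B_def S_def)
      then have "(s - b) * A \<le> (S - B) * (a - b) + (s - b) * B"
        using a s1 by (simp add: field_simps)
      then have "(a - b) * A - (s - a) * B \<le> (a - b) * S - (s - a) * A"
        by (simp add: algebra_simps)
      also have "\<dots> \<le> (a - b) * S"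
        using s1 \<open>A > 0\<close> by simp
      finally have 1: "(a - b) * A - (s - a) * B \<le> (a - b) * S" .
      have "(s - a) * B \<le> R * A * B"
        using s \<open>B > 0\<close> by (intro mult_right_mono) (auto simp: A_def)
      moreover have "4 * R * B \<le> 2 * (a - b)"
      proof -
        have "4 * R * B \<le> 1 - b"
          using b(1) \<phi>b by (simp add: B_def field_simps)
        then show ?thesis
          using a by simp
      qed
      then have "(R * B) * A \<le> ((a - b) / 2) * A"
        using \<open>A > 0\<close> by (intro mult_right_mono) auto
      ultimately have "(a - b) * A \<le> (a - b) * (2 * S)"
        using 1 by (simp add: algebra_simps)
      then have "A \<le> 2 * S"
        using a by simp
      then show ?thesis
        using \<phi>a \<phi>s by (simp add: A_def S_def field_simps)
    qed
    with less1 a show ?case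
      by auto
  qed
qed

section \<open>Stereographic projection: range, differential and Lipschitz bound\<close>

text \<open>This gives closedness of the range, so that limits of sphere points are sphere points. A
  point \<open>(w, t)\<close> with \<open>t \<noteq> 1\<close> comes from
  \<open>w / (1 - t)\<close>, and \<open>t = 1\<close> leaves only the north pole.\<close>

lemma range_sphere_point: "range sphere_point = sphere 0 1"
proof (intro equalityI subsetI)
  fix q assume "q \<in> range sphere_point"
  then obtain p where p: "q = sphere_point p" by auto
  show "q \<in> sphere 0 1"
  proof (cases p)
    case (Fin z)
    define a where "a = 1 + (norm z)\<^sup>2"
    have a: "a > 0" "(norm z)\<^sup>2 = a - 1"
      using one_plus_sq_pos[of z] by (auto simp: a_def)
    have "(norm ((2 / a) *\<^sub>R z))\<^sup>2 + (norm ((a - 2) / a))\<^sup>2 = 1"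
      unfolding norm_scaleR power_mult_distrib a(2) using a(1)
      by (simp add: field_simps power2_eq_square)
    moreover have "q = ((2 / a) *\<^sub>R z, (a - 2) / a)"
      unfolding p Fin by (auto simp: a_def algebra_simps)
    ultimately show ?thesis
      by (simp add: norm_Pair)
  qed (simp add: p)
next
  fix q :: "complex \<times> real" assume q: "q \<in> sphere 0 1"
  obtain w t where wt: "q = (w, t)" by fastforce
  have eq: "(norm w)\<^sup>2 = 1 - t\<^sup>2"
    using q by (simp add: wt norm_Pair)
  show "q \<in> range sphere_point"
  proof (cases "t = 1")
    case True
    with eq show ?thesis
      by (intro image_eqI[of _ _ Infty]) (auto simp: wt)
  next
    case False
    have "t\<^sup>2 \<le> 1"
      using eq by (metis diff_ge_0_iff_ge zero_le_power2)
    with False have t: "1 - t > 0"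
      by (simp add: abs_square_le_1)
    have n: "(norm (w /\<^sub>R (1 - t)))\<^sup>2 = (1 + t) / (1 - t)"
    proof -
      have factored: "(norm w)\<^sup>2 = (1 - t) * (1 + t)"
        unfolding eq by (simp add: power2_eq_square algebra_simps)
      have cancel: "(inverse b)\<^sup>2 * (b * c) = c / b" if "b \<noteq> 0" for b c :: real
        using that by (simp add: power2_eq_square field_simps)
      show ?thesis
        unfolding norm_scaleR power_mult_distrib factored power2_abs using cancel[of "1 - t"] t by simp
    qed
    have "1 + (1 + t) / (1 - t) = 2 / (1 - t)" "((1 + t) / (1 - t) - 1) / ((1 + t) / (1 - t) + 1) = t"
      "(2 - 2 * t) * inverse (1 - t) = 2"
      using t by (simp_all add: divide_simps)
    then have "sphere_point (Fin (w /\<^sub>R (1 - t))) = (w, t)"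
      unfolding sphere_point.simps n using t by simp
    then show ?thesis
      by (metis wt rangeI)
  qed
qed

text \<open>With the last coordinate written as \<open>1 - 2 / (1 + z \<bullet> z)\<close>, a single
  scalar function has to be differentiated.\<close>

lemma has_derivative_sphere_point_Fin:
  fixes z :: complex
  defines "a \<equiv> 1 + (norm z)\<^sup>2"
  shows "((\<lambda>z. sphere_point (Fin z)) has_derivative
    (\<lambda>v. ((2 / a) *\<^sub>R v - (4 * (z \<bullet> v) / a\<^sup>2) *\<^sub>R z, 4 * (z \<bullet> v) / a\<^sup>2))) (at z)"
proof -
  have sp: "sphere_point (Fin z) = ((2 / (1 + z \<bullet> z)) *\<^sub>R z, 1 - 2 / (1 + z \<bullet> z))" for z
    using one_plus_sq_pos[of z] by (simp add: power2_norm_eq_inner field_simps)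
  have a: "a = 1 + z \<bullet> z" "a > 0"
    using one_plus_sq_pos[of z] by (simp_all add: a_def power2_norm_eq_inner)
  have d: "((\<lambda>z. 2 / (1 + z \<bullet> z)) has_derivative (\<lambda>v. - (4 * (z \<bullet> v) / a\<^sup>2))) (at z)"
    using a by (auto intro!: derivative_eq_intros simp: inner_commute power2_eq_square field_simps)
  show ?thesis
    unfolding sp
  proof (rule has_derivative_eq_rhs)
    show "((\<lambda>z. ((2 / (1 + z \<bullet> z)) *\<^sub>R z, 1 - 2 / (1 + z \<bullet> z))) has_derivative
        (\<lambda>v. ((2 / (1 + z \<bullet> z)) *\<^sub>R v + (- (4 * (z \<bullet> v) / a\<^sup>2)) *\<^sub>R z,
          0 - (- (4 * (z \<bullet> v) / a\<^sup>2))))) (at z)"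
      by (rule has_derivative_Pair[OF has_derivative_scaleR[OF d has_derivative_ident]
            has_derivative_diff[OF has_derivative_const d]])
  qed (simp add: a(1))
qed

text \<open>Conformality of the projection: every vector is scaled by the same factor
  \<open>2 / a\<close>. This factor accounts for the denominator in
  \<open>harmonic_sharp\<close>.\<close>

lemma norm_derivative_sphere_point_Fin:
  fixes z v :: complex
  defines "a \<equiv> 1 + (norm z)\<^sup>2"
  shows "norm ((2 / a) *\<^sub>R v - (4 * (z \<bullet> v) / a\<^sup>2) *\<^sub>R z, 4 * (z \<bullet> v) / a\<^sup>2) = 2 * norm v / a"
proof -
  have a: "z \<bullet> z = a - 1" "a > 0"
    using one_plus_sq_pos[of z] by (simp_all add: a_def power2_norm_eq_inner)
  define k where "k = 4 * (z \<bullet> v) / a\<^sup>2"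
  \<comment> \<open>The mixed term becomes \<open>- k\<^sup>2 * a\<close> and cancels the two terms
    in \<open>k\<^sup>2\<close>, because \<open>z \<bullet> z = a - 1\<close>.\<close>
  have k: "4 / a * (z \<bullet> v) = k * a"
    using a by (simp add: k_def power2_eq_square)
  have "(norm ((2 / a) *\<^sub>R v - k *\<^sub>R z))\<^sup>2 + (norm k)\<^sup>2
      = (2 / a)\<^sup>2 * (v \<bullet> v) - 4 / a * (z \<bullet> v) * k + k\<^sup>2 * (z \<bullet> z) + k\<^sup>2"
    unfolding power2_norm_eq_inner
    by (simp add: inner_diff_left inner_diff_right inner_commute power2_eq_square algebra_simps)
  also have "\<dots> = (2 * norm v / a)\<^sup>2"
    unfolding k a(1) by (simp add: power2_norm_eq_inner[symmetric] power2_eq_square algebra_simps)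
  finally have "(norm ((2 / a) *\<^sub>R v - k *\<^sub>R z))\<^sup>2 + (norm k)\<^sup>2 = (2 * norm v / a)\<^sup>2" .
  then show ?thesis
    unfolding k_def[symmetric] using a by (simp add: norm_Pair del: real_norm_def)
qed

text \<open>The differential of \<open>f\<close> has norm at most
  \<open>norm (deriv h z) + norm (deriv g z)\<close>, and the conformal factor at \<open>f z\<close>
  supplies \<open>2 / (1 + (norm (f z))\<^sup>2)\<close>. The composition with
  \<open>sphere_point\<close> thus has differential of norm at most \<open>2 * L\<close>, and the
  mean value inequality on the convex set \<open>S\<close> applies in the Euclidean space around the
  sphere.\<close>

lemma chordal_lipschitz:
  assumes "open D" "S \<subseteq> D" "convex S" "canonical_decomposition D z0 f h g"
    and L: "\<And>z. z \<in> S \<Longrightarrow> (norm (deriv h z) + norm (deriv g z)) / (1 + (norm (f z))\<^sup>2) \<le> L"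
    and "x \<in> S" "y \<in> S"
  shows "dist (Fin (f x)) (Fin (f y)) \<le> 2 * L * dist x y"
proof -
  have f: "h holomorphic_on D" "g holomorphic_on D" "\<And>z. z \<in> D \<Longrightarrow> f z = h z + cnj (g z)"
    using assms(4) by (auto simp: canonical_decomposition_def)
  define f' where "f' z w = deriv h z * w + cnj (deriv g z * w)" for z w
  define P where "P a v = ((2 / (1 + (norm a)\<^sup>2)) *\<^sub>R v - (4 * (a \<bullet> v) / (1 + (norm a)\<^sup>2)\<^sup>2) *\<^sub>R a,
    4 * (a \<bullet> v) / (1 + (norm a)\<^sup>2)\<^sup>2)" for a v :: complex
  have df: "(f has_derivative f' z) (at z)" if "z \<in> D" for z
  proof -
    have "((\<lambda>z. h z + cnj (g z)) has_derivative f' z) (at z)"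
      unfolding f'_def
      using holomorphic_derivI[OF f(1) \<open>open D\<close> that] holomorphic_derivI[OF f(2) \<open>open D\<close> that]
      unfolding has_field_derivative_def by (intro has_derivative_add has_derivative_cnj)
    then show ?thesis
      by (rule has_derivative_transform_within_open[OF _ \<open>open D\<close> that]) (simp add: f)
  qed
  have "norm (sphere_point (Fin (f x)) - sphere_point (Fin (f y))) \<le> (2 * L) * norm (x - y)"
  proof (rule differentiable_bound[OF \<open>convex S\<close> _ _ \<open>x \<in> S\<close> \<open>y \<in> S\<close>])
    fix z assume z: "z \<in> S"
    show "((\<lambda>z. sphere_point (Fin (f z))) has_derivative (\<lambda>w. P (f z) (f' z w))) (at z within S)"
      using has_derivative_compose[OF has_derivative_at_withinI[OF df] has_derivative_sphere_point_Fin]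
        z \<open>S \<subseteq> D\<close> unfolding P_def by blast
    show "onorm (\<lambda>w. P (f z) (f' z w)) \<le> 2 * L"
    proof (rule onorm_le)
      fix w
      have "norm (f' z w) \<le> (norm (deriv h z) + norm (deriv g z)) * norm w"
        unfolding f'_def using norm_triangle_ineq[of "deriv h z * w" "cnj (deriv g z * w)"]
        by (simp add: norm_mult algebra_simps)
      then have "2 * norm (f' z w) / (1 + (norm (f z))\<^sup>2)
          \<le> 2 * ((norm (deriv h z) + norm (deriv g z)) * norm w) / (1 + (norm (f z))\<^sup>2)"
        using one_plus_sq_pos[of "f z"] by (intro divide_right_mono) auto
      also have "\<dots> = 2 * ((norm (deriv h z) + norm (deriv g z)) / (1 + (norm (f z))\<^sup>2)) * norm w"
        by simp
      also have "\<dots> \<le> 2 * L * norm w"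
        using L[OF z] by (intro mult_right_mono mult_left_mono) auto
      finally show "norm (P (f z) (f' z w)) \<le> 2 * L * norm w"
        unfolding P_def norm_derivative_sphere_point_Fin .
    qed
  qed
  then show ?thesis
    by (simp only: dist_riemann_sphere_def dist_norm)
qed

section \<open>Compactness for the chordal metric\<close>

text \<open>The sphere is a compact subset of a Euclidean space, so Arzela-Ascoli applies to the
  compositions with \<open>sphere_point\<close> and the limit stays on the sphere.\<close>

lemma riemann_sphere_arzela_ascoli:
  fixes F :: "nat \<Rightarrow> 'a::euclidean_space \<Rightarrow> riemann_sphere"
  assumes "compact K"
    and lip: "\<forall>\<^sub>F n in sequentially. \<forall>x\<in>K. \<forall>y\<in>K. dist (F n x) (F n y) \<le> L * dist x y"
  obtains r G where "strict_mono (r :: nat \<Rightarrow> nat)" "uniform_limit K (\<lambda>n. F (r n)) G sequentially"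
proof -
  obtain N where N: "\<And>n x y. n \<ge> N \<Longrightarrow> x \<in> K \<Longrightarrow> y \<in> K \<Longrightarrow> dist (F n x) (F n y) \<le> L * dist x y"
    using lip by (auto simp: eventually_sequentially)
  \<comment> \<open>The shift by \<open>N\<close> makes the Lipschitz bound hold for every index; it
    reappears in the final subsequence.\<close>
  define Q where "Q n x = sphere_point (F (n + N) x)" for n x
  \<comment> \<open>\<open>L\<close> may be zero or negative, while the radius \<open>e / L'\<close>
    needs a positive constant.\<close>
  define L' where "L' = max L 1"
  have L': "L' > 0" "L \<le> L'"
    by (auto simp: L'_def)
  have Q1: "norm (Q n x) = 1" for n x
  proof -
    have "Q n x \<in> sphere 0 1"
      unfolding range_sphere_point[symmetric] Q_def by blast
    then show ?thesis by simp
  qed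
  have QL: "norm (Q n x - Q n y) \<le> L' * norm (x - y)" if "x \<in> K" "y \<in> K" for n x y
  proof -
    have "norm (Q n x - Q n y) \<le> L * norm (x - y)"
      using N[OF _ that, of "n + N"] by (simp add: Q_def dist_riemann_sphere_def dist_norm)
    also have "\<dots> \<le> L' * norm (x - y)"
      using L' by (intro mult_right_mono) auto
    finally show ?thesis .
  qed
  obtain q k where k: "strict_mono (k :: nat \<Rightarrow> nat)"
    and q: "\<And>e. 0 < e \<Longrightarrow> \<exists>N. \<forall>n x. n \<ge> N \<and> x \<in> K \<longrightarrow> norm (Q (k n) x - q x) < e"
  proof (rule Arzela_Ascoli[OF \<open>compact K\<close>, of Q 1])
    fix x and e :: real assume "x \<in> K" "0 < e"
    show "\<exists>d>0. \<forall>n y. y \<in> K \<and> norm (x - y) < d \<longrightarrow> norm (Q n x - Q n y) < e"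
    proof (intro exI[of _ "e / L'"] conjI allI impI)
      fix n y assume y: "y \<in> K \<and> norm (x - y) < e / L'"
      have "norm (Q n x - Q n y) \<le> L' * norm (x - y)"
        using QL \<open>x \<in> K\<close> y by blast
      also have "\<dots> < e"
        using y L' by (simp add: field_simps)
      finally show "norm (Q n x - Q n y) < e" .
    qed (use \<open>0 < e\<close> L' in auto)
  qed (auto simp: Q1)
  have lim: "uniform_limit K (\<lambda>n. Q (k n)) q sequentially"
    using q by (auto simp: uniform_limit_iff eventually_sequentially dist_norm) metis
  \<comment> \<open>Since the sphere is closed, the limit can be pulled back through
    \<open>sphere_point\<close>, which is an isometry by the definition of the chordal
    metric.\<close>
  have "q x \<in> range sphere_point" if "x \<in> K" for x
  proof (rule Lim_in_closed_set)
    show "((\<lambda>n. Q (k n) x) \<longlongrightarrow> q x) sequentially"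
      using tendsto_uniform_limitI[OF lim that] .
  qed (auto simp: range_sphere_point Q1)
  then have inv: "sphere_point (inv sphere_point (q x)) = q x" if "x \<in> K" for x
    using that by (simp add: f_inv_into_f)
  have "uniform_limit K (\<lambda>n. F (k n + N)) (\<lambda>x. inv sphere_point (q x)) sequentially"
    using lim by (auto simp: uniform_limit_iff dist_riemann_sphere_def inv Q_def)
  moreover have "strict_mono (\<lambda>n. k n + N)"
    using k by (auto simp: strict_mono_def)
  ultimately show thesis
    using that by blast
qed

lemma compact_subset_cball_nat:
  assumes "compact (K :: 'a::real_normed_vector set)"
  obtains m where "K \<subseteq> cball 0 (real m)"
proof -
  obtain b where "\<And>x. x \<in> K \<Longrightarrow> norm x \<le> b"
    using compact_imp_bounded[OF assms] by (auto simp: bounded_iff)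
  then have "K \<subseteq> cball 0 (real (nat \<lceil>b\<rceil>))"
    using real_nat_ceiling_ge[of b] by (metis mem_cball_0 order_trans subsetI)
  then show thesis ..
qed

text \<open>The bounds hold only from an index depending on \<open>m\<close>, as suits functions
  controlled on growing discs. Arzela-Ascoli on the balls of integer radius and a diagonal
  subsequence reach every compact set.\<close>

lemma riemann_sphere_montel:
  fixes F :: "nat \<Rightarrow> 'a::euclidean_space \<Rightarrow> riemann_sphere"
  assumes lip: "\<And>m. \<forall>\<^sub>F n in sequentially. \<forall>x\<in>cball 0 (real m). \<forall>y\<in>cball 0 (real m).
      dist (F n x) (F n y) \<le> L m * dist x y"
  obtains r G where "strict_mono (r :: nat \<Rightarrow> nat)"
    "\<And>K. compact K \<Longrightarrow> uniform_limit K (\<lambda>n. F (r n)) G sequentially"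
proof -
  define P where "P m s \<longleftrightarrow> (\<exists>G. uniform_limit (cball 0 (real m)) (\<lambda>n. F (s n)) G sequentially)"
    for m and s :: "nat \<Rightarrow> nat"
  interpret subseqs P
  proof
    fix m :: nat and s :: "nat \<Rightarrow> nat" assume s: "strict_mono s"
    obtain r G where "strict_mono (r :: nat \<Rightarrow> nat)"
      "uniform_limit (cball 0 (real m)) (\<lambda>n. F (s (r n))) G sequentially"
      by (rule riemann_sphere_arzela_ascoli[OF compact_cball
            eventually_compose_filterlim[OF lip filterlim_subseq[OF s]]])
    then show "\<exists>r. strict_mono r \<and> P m (s \<circ> r)"
      by (auto simp: P_def)
  qed
  \<comment> \<open>From index \<open>Suc m\<close> on, the diagonal sequence is a subsequence of
    the one extracted for radius \<open>m\<close>.\<close>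
  have "P m (diagseq \<circ> ((+) (Suc m)))" for m
  proof (rule diagseq_holds)
    fix r s :: "nat \<Rightarrow> nat" and m assume r: "strict_mono r" and "P m s"
    then obtain H where "uniform_limit (cball 0 (real m)) (\<lambda>n. F (s n)) H sequentially"
      by (auto simp: P_def)
    from filterlim_compose[OF this filterlim_subseq[OF r]] show "P m (s \<circ> r)"
      unfolding P_def comp_def by (rule exI[of _ H])
  qed
  then have "\<forall>m. \<exists>H. uniform_limit (cball 0 (real m)) (\<lambda>n. F (diagseq (Suc m + n))) H sequentially"
    by (simp only: P_def comp_def) blast
  from choice[OF this] obtain H
    where H: "\<And>m. uniform_limit (cball 0 (real m)) (\<lambda>n. F (diagseq (Suc m + n))) (H m) sequentially"
    by blast
  have H': "uniform_limit (cball 0 (real m)) (\<lambda>n. F (diagseq n)) (H m) sequentially" for m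
    using H[of m] unfolding uniform_limit_iff add.commute[of "Suc m"]
    by (subst (asm) eventually_sequentially_seg)
  \<comment> \<open>The limits \<open>H m\<close> are glued: each point takes its value from the
    smallest ball of integer radius containing it, and uniqueness of pointwise limits makes the
    choice immaterial.\<close>
  define G where "G x = H (nat \<lceil>norm x\<rceil>) x" for x
  have HG: "H m x = G x" if "x \<in> cball 0 (real m)" for m x
  proof (rule LIMSEQ_unique)
    show "(\<lambda>n. F (diagseq n) x) \<longlonglongrightarrow> H m x"
      using tendsto_uniform_limitI[OF H' that] .
    show "(\<lambda>n. F (diagseq n) x) \<longlonglongrightarrow> G x"
      unfolding G_def by (rule tendsto_uniform_limitI[OF H']) (simp add: real_nat_ceiling_ge)
  qed
  have "uniform_limit K (\<lambda>n. F (diagseq n)) G sequentially" if "compact K" for K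
  proof -
    obtain m where sub: "K \<subseteq> cball 0 (real m)"
      using compact_subset_cball_nat[OF \<open>compact K\<close>] .
    have "uniform_limit K (\<lambda>n. F (diagseq n)) (H m) sequentially"
      using uniform_limit_on_subset[OF H' sub] .
    then show ?thesis
      using HG sub by (subst uniform_limit_cong'[where g = "\<lambda>n. F (diagseq n)" and i = "H m"]) (auto simp: subset_eq)
  qed
  then show thesis
    using that subseq_diagseq by blast
qed

section \<open>Rescaling near the unit circle\<close>

theorem theorem1p4:
  fixes f :: "complex \<Rightarrow> complex" and \<phi> :: "real \<Rightarrow> real" and z0 :: complex
    and z :: "nat \<Rightarrow> complex"
  assumes "z0 \<in> ball 0 1"
    and "harmonic_on f (ball 0 1)"
    and "\<And>r. r \<in> {0..<1} \<Longrightarrow> \<phi> r > 0"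
    and "mono_on {0..<1} \<phi>"
    and "convex_on {0..<1} (\<lambda>r. 1 / \<phi> r)"
    and "filterlim (\<lambda>r. \<phi> r * (1 - r)) at_top (at_left 1)"
    and "phi_normal \<phi> z0 f"
    and "\<And>n. z n \<in> ball 0 1"
    and "(\<lambda>n. norm (z n)) \<longlonglongrightarrow> 1"
  shows "normal_sequence_in UNIV
    (\<lambda>n. {w. z n + w / of_real (\<phi> (norm (z n))) \<in> ball 0 1})
    (\<lambda>n w. f (z n + w / of_real (\<phi> (norm (z n)))))"
proof -
  let ?\<phi> = "\<lambda>n. \<phi> (norm (z n))"
  define A where "A n = {w. z n + w / of_real (?\<phi> n) \<in> ball 0 1}" for n
  define F where "F n w = f (z n + w / of_real (?\<phi> n))" for n w
  obtain h g where dec: "canonical_decomposition (ball 0 1) z0 f h g"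
    using harmonic_on_imp_canonical_decomposition[OF assms(2) convex_ball] .
  obtain M0 where M0: "\<And>\<zeta>. \<zeta> \<in> ball 0 1 \<Longrightarrow> harmonic_sharp (ball 0 1) z0 f \<zeta> / \<phi> (norm \<zeta>) \<le> M0"
    using assms(7) by (force simp: phi_normal_def bdd_above_def)
  \<comment> \<open>Nonnegative, so that the bound on \<open>\<phi>\<close> may be multiplied by
    it.\<close>
  define M where "M = max M0 0"
  have "M \<ge> 0"
    by (simp add: M_def)
  have sharp: "(norm (deriv h \<zeta>) + norm (deriv g \<zeta>)) / (1 + (norm (f \<zeta>))\<^sup>2) \<le> M * \<phi> (norm \<zeta>)"
    if "\<zeta> \<in> ball 0 1" for \<zeta>
  proof -
    have "harmonic_sharp (ball 0 1) z0 f \<zeta> \<le> M * \<phi> (norm \<zeta>)"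
      using M0[OF that] assms(3)[of "norm \<zeta>"] that by (simp add: M_def pos_divide_le_eq[symmetric])
    then show ?thesis
      by (simp add: harmonic_sharp_eq[OF open_ball that dec])
  qed
  have at_left: "filterlim (\<lambda>n. norm (z n)) (at_left 1) sequentially"
    using assms(8,9) by (intro tendsto_imp_filterlim_at_left) auto
  \<comment> \<open>In \<open>4 * M\<close> one factor 2 comes from the chordal metric and one from
    the doubling of \<open>\<phi>\<close>. The scale \<open>?\<phi> n\<close> in the bound on the
    derivative cancels against the contraction by the rescaling.\<close>
  have ev: "\<forall>\<^sub>F n in sequentially. cball 0 (real m) \<subseteq> A n \<and>
      (\<forall>x\<in>cball 0 (real m). \<forall>y\<in>cball 0 (real m). dist (Fin (F n x)) (Fin (F n y)) \<le> 4 * M * dist x y)" for m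
    using eventually_compose_filterlim[OF phi_doubling[OF assms(3-6), of "real m"] at_left, simplified]
  proof eventually_elim
    case (elim n)
    define u where "u = ?\<phi> n"
    \<comment> \<open>The rescaling maps the disc of radius \<open>m\<close> into \<open>S\<close>,
      on which the doubling estimate holds with \<open>R = m\<close>.\<close>
    define S where "S = cball (z n) (real m / u)"
    have "u > 0"
      using assms(3)[of "norm (z n)"] elim by (simp add: u_def)
    have S: "norm \<zeta> < 1" "\<phi> (norm \<zeta>) \<le> 2 * u" if "\<zeta> \<in> S" for \<zeta>
    proof -
      have "norm \<zeta> \<le> norm (z n) + real m / u"
        using that norm_triangle_ineq2[of \<zeta> "z n"] by (simp add: S_def dist_norm norm_minus_commute)
      then show "norm \<zeta> < 1" "\<phi> (norm \<zeta>) \<le> 2 * u"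
        using elim by (auto simp: u_def)
    qed
    have in_S: "z n + x / of_real u \<in> S" if "x \<in> cball 0 (real m)" for x
      using that \<open>u > 0\<close> by (simp add: S_def dist_norm norm_divide divide_right_mono)
    have "dist (Fin (F n x)) (Fin (F n y)) \<le> 4 * M * dist x y"
      if "x \<in> cball 0 (real m)" "y \<in> cball 0 (real m)" for x y
    proof -
      have "dist (Fin (F n x)) (Fin (F n y))
          \<le> 2 * (M * (2 * u)) * dist (z n + x / of_real u) (z n + y / of_real u)"
        unfolding F_def u_def[symmetric]
      proof (rule chordal_lipschitz[OF open_ball _ _ dec])
        fix \<zeta> assume \<zeta>: "\<zeta> \<in> S"
        have "(norm (deriv h \<zeta>) + norm (deriv g \<zeta>)) / (1 + (norm (f \<zeta>))\<^sup>2) \<le> M * \<phi> (norm \<zeta>)"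
          using S(1)[OF \<zeta>] by (intro sharp) simp
        also have "\<dots> \<le> M * (2 * u)"
          using S(2)[OF \<zeta>] \<open>M \<ge> 0\<close> by (rule mult_left_mono)
        finally show "(norm (deriv h \<zeta>) + norm (deriv g \<zeta>)) / (1 + (norm (f \<zeta>))\<^sup>2) \<le> M * (2 * u)" .
      qed (use S(1) in_S that in \<open>auto simp: S_def\<close>)
      also have "dist (z n + x / of_real u) (z n + y / of_real u) = dist x y / u"
        using \<open>u > 0\<close> by (simp add: dist_norm diff_divide_distrib[symmetric] norm_divide)
      finally show ?thesis
        using \<open>u > 0\<close> by simp
    qed
    then show ?case
      using S(1) in_S by (auto simp: A_def u_def)
  qed
  show ?thesis
    unfolding normal_sequence_in_def A_def[symmetric] F_def[symmetric]
  proof (intro allI impI)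
    fix \<sigma> :: "nat \<Rightarrow> nat" assume \<sigma>: "filterlim \<sigma> at_top sequentially"
    \<comment> \<open>Only divergence of \<open>\<sigma>\<close> is used: what holds for all late
      \<open>n\<close> holds along \<open>\<sigma>\<close>, monotone or not.\<close>
    note ev' = eventually_compose_filterlim[OF ev \<sigma>]
    obtain r G where r: "strict_mono (r :: nat \<Rightarrow> nat)"
      and G: "\<And>K. compact K \<Longrightarrow> uniform_limit K (\<lambda>k w. Fin (F (\<sigma> (r k)) w)) G sequentially"
    proof (rule riemann_sphere_montel)
      show "\<forall>\<^sub>F k in sequentially. \<forall>x\<in>cball 0 (real m). \<forall>y\<in>cball 0 (real m).
          dist (Fin (F (\<sigma> k) x)) (Fin (F (\<sigma> k) y)) \<le> 4 * M * dist x y" for m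
        using ev'[of m] by eventually_elim blast
    qed blast
    have "\<forall>\<^sub>F k in sequentially. K \<subseteq> A (\<sigma> (r k))" if "compact K" for K
    proof -
      obtain m where "K \<subseteq> cball 0 (real m)"
        using compact_subset_cball_nat[OF \<open>compact K\<close>] .
      with eventually_compose_filterlim[OF ev'[of m] filterlim_subseq[OF r]] show ?thesis
        by (auto elim!: eventually_mono)
    qed
    with r G show "\<exists>\<rho> G. strict_mono \<rho> \<and> (\<forall>K. compact K \<and> K \<subseteq> UNIV \<longrightarrow>
        (\<forall>\<^sub>F k in sequentially. K \<subseteq> A (\<sigma> (\<rho> k))) \<and>
        uniform_limit K (\<lambda>k w. Fin (F (\<sigma> (\<rho> k)) w)) G sequentially)"
      by blast
  qed
qed

end
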